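(* Let $m \ge n \ge 1$, let $A \in \mathbb{C}^{m\times n}$ have full rank, let $b \in \mathbb{C}^m$ be such that the linear system $Ax = b$ is consistent, and let $x \in \mathbb{C}^n$ be its solution. Then there exists an initial approximation $x_0 \in \mathbb{C}^n$, $x_0 \ne x$, such that the random iterates $x_1, x_2, \ldots$ produced from $x_0$ by the random Kaczmarz algorithm applied to $Ax=b$ satisfy $$\mathbb{E}\,\|x_k - x\|_2^2 \ge \bigl(1 - 2k/\kappa(A)^2\bigr)\cdot \|x_0 - x\|_2^2 \qquad \text{for all } k = 1, 2, \ldots,$$ where $\kappa(A) = \|A\|_F \|A^{-1}\|_2$ is the scaled condition number of $A$.
   Context: Notation. $\|\cdot\|_2$ on vectors is the Euclidean norm, and $\langle u, v\rangle = u^* v$ is the standard inner product on $\mathbb{C}^n$. The rows of $A$ are denoted $a_1^*, \ldots, a_m^*$ with $a_j \in \mathbb{C}^n$, and $b = (b_1,\ldots,b_m)^T$, so that the $j$-th equation of the system $Ax=b$ is $\langle a_j, x\rangle = b_j$. $\|A\|_F$ is the Frobenius norm, so $\|A\|_F^2 = \sum_{j=1}^m \|a_j\|_2^2$. Since $A$ has full rank and $m \ge n$, it has a left inverse, denoted $A^{-1}$; the quantity $\|A^{-1}\|_2$ is the smallest constant $M$ such that $\|Az\|_2 \ge \frac{1}{M}\|z\|_2$ for all vectors $z \in \mathbb{C}^n$ (i.e. the reciprocal of the smallest singular value of $A$). The scaled condition number of $A$ is $\kappa(A) := \|A\|_F\|A^{-1}\|_2$. Random Kaczmarz algorithm. Starting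 from a fixed $x_0 \in \mathbb{C}^n$, for $k = 0, 1, 2, \ldots$ choose an index $r \in \{1,\ldots,m\}$ at random, independently of all previous choices, with $\mathbb{P}(r = j) = \|a_j\|_2^2/\|A\|_F^2$ for $j=1,\ldots,m$, and set $$x_{k+1} = x_k + \frac{b_r - \langle a_r, x_k\rangle}{\|a_r\|_2^2}\, a_r .$$ The expectation $\mathbb{E}$ is over all the random choices of indices. *)

theory Defs
  imports "HOL-Probability.Probability"
begin

definition cinner_vec :: "complex ^ 'n \<Rightarrow> complex ^ 'n \<Rightarrow> complex" where
  "cinner_vec u v = (\<Sum>i\<in>UNIV. cnj (u $ i) * v $ i)"

text \<open>The rows of \<open>A\<close> are the conjugate transposes of the vectors \<open>a\<^sub>j\<close>. Hence \<open>a\<^sub>j\<close>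
  is the entrywise conjugate of \<open>A $ j\<close>, and the inner product of \<open>a\<^sub>j\<close> with \<open>z\<close> is
  the \<open>j\<close>-th entry of \<open>A *v z\<close>.\<close>

definition row_vec :: "complex ^ 'n ^ 'm \<Rightarrow> 'm \<Rightarrow> complex ^ 'n" where
  "row_vec A j = (\<chi> i. cnj (A $ j $ i))"

lemma cinner_row_vec: "cinner_vec (row_vec A j) z = (A *v z) $ j"
  by (simp add: cinner_vec_def row_vec_def matrix_vector_mult_def)

definition frobenius_norm :: "complex ^ 'n ^ 'm \<Rightarrow> real" where
  "frobenius_norm A = sqrt (\<Sum>j\<in>UNIV. \<Sum>i\<in>UNIV. (cmod (A $ j $ i))\<^sup>2)"

lemma frobenius_norm_eq_norm: "frobenius_norm A = norm A"
  by (simp add: frobenius_norm_def norm_vec_def L2_set_def sum_nonneg)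

lemma frobenius_norm_sq: "(frobenius_norm A)\<^sup>2 = (\<Sum>j\<in>UNIV. (norm (row_vec A j))\<^sup>2)"
  by (simp add: frobenius_norm_def row_vec_def norm_vec_def L2_set_def sum_nonneg)

text \<open>For a rectangular \<open>A\<close> the spectral norm of its left inverse is understood as the smallest
  constant \<open>M\<close> in the lower bound below. The guard \<open>M > 0\<close> is needed because a nonpositive
  \<open>M\<close> satisfies the bound trivially (\<open>1 / 0 = 0\<close>). The least element exists when \<open>A\<close>
  is injective, and is not meaningful otherwise.\<close>

definition inverse_norm :: "complex ^ 'n ^ 'm \<Rightarrow> real" where
  "inverse_norm A = (LEAST M. M > 0 \<and> (\<forall>z. norm (A *v z) \<ge> (1 / M) * norm z))"

lemma inverse_norm_least:
  fixes A :: "complex ^ 'n ^ 'm"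
  assumes inj: "inj ((*v) A)"
  shows "inverse_norm A > 0"
    and "norm (A *v z) \<ge> (1 / inverse_norm A) * norm z"
    and "M > 0 \<Longrightarrow> (\<And>z. norm (A *v z) \<ge> (1 / M) * norm z) \<Longrightarrow> inverse_norm A \<le> M"
proof -
  let ?S = "sphere (0 :: complex ^ 'n) 1"
  have lin: "linear ((*v) A)"
    by (intro linearI) (simp_all add: matrix_vector_right_distrib matrix_vector_mult_def
        vec_eq_iff scaleR_sum_right
        distrib_left sum.distrib)
  have cont: "continuous_on ?S (\<lambda>z. norm (A *v z))"
    by (intro continuous_on_norm linear_continuous_on linear_conv_bounded_linear[THEN iffD1] lin)
  have "axis undefined (1::complex) \<in> ?S"
    by (simp add: norm_axis_1)
  hence ne: "?S \<noteq> {}" by blast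
  obtain v where v: "v \<in> ?S" and vmin: "\<And>z. z \<in> ?S \<Longrightarrow> norm (A *v v) \<le> norm (A *v z)"
    using continuous_attains_inf[OF compact_sphere ne cont] by blast
  have "v \<noteq> 0" using v by auto
  hence "A *v v \<noteq> 0"
    using injD[OF inj, of v 0] by auto
  hence pos: "norm (A *v v) > 0" by simp
  have lower: "norm (A *v z) \<ge> norm (A *v v) * norm z" for z
  proof (cases "z = 0")
    case False
    have "norm (A *v v) \<le> norm (A *v ((1 / norm z) *\<^sub>R z))"
      using False by (intro vmin) simp
    also have "A *v ((1 / norm z) *\<^sub>R z) = (1 / norm z) *\<^sub>R (A *v z)"
      using lin by (simp add: linear_scale)
    also have "norm \<dots> = norm (A *v z) / norm z"
      by simp
    finally show ?thesis
      using False by (simp add: pos_le_divide_eq)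
  qed simp
  have eq: "inverse_norm A = 1 / norm (A *v v)"
    unfolding inverse_norm_def
  proof (rule Least_equality)
    show "1 / norm (A *v v) > 0 \<and> (\<forall>z. norm (A *v z) \<ge> (1 / (1 / norm (A *v v))) * norm z)"
      using pos lower by simp
  next
    fix M :: real
    assume M: "M > 0 \<and> (\<forall>z. norm (A *v z) \<ge> (1 / M) * norm z)"
    hence "norm (A *v v) \<ge> (1 / M) * norm v" by blast
    with v M pos show "1 / norm (A *v v) \<le> M"
      by (simp add: field_simps)
  qed
  show "inverse_norm A > 0" using eq pos by simp
  show "norm (A *v z) \<ge> (1 / inverse_norm A) * norm z" using eq lower by simp
  assume M: "M > 0" "\<And>z. norm (A *v z) \<ge> (1 / M) * norm z"
  show "inverse_norm A \<le> M"
    using M(1) M(2)[of v] v pos by (simp add: eq field_simps)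
qed

definition scaled_cond :: "complex ^ 'n ^ 'm \<Rightarrow> real" where
  "scaled_cond A = frobenius_norm A * inverse_norm A"

text \<open>\<open>r k\<close> is the row index used in the step from the \<open>k\<close>-th to the \<open>(k+1)\<close>-th
  iterate. A zero row would leave the iterate unchanged, but is selected with probability \<open>0\<close>.\<close>

primrec kaczmarz ::
  "complex ^ 'n ^ 'm \<Rightarrow> complex ^ 'm \<Rightarrow> complex ^ 'n \<Rightarrow> (nat \<Rightarrow> 'm) \<Rightarrow> nat \<Rightarrow> complex ^ 'n"
where
  "kaczmarz A b x0 r 0 = x0"
| "kaczmarz A b x0 r (Suc k) =
     (let y = kaczmarz A b x0 r k; a = row_vec A (r k)
      in y + ((b $ r k - cinner_vec a y) / of_real ((norm a)\<^sup>2)) *s a)"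

definition kaczmarz_sampling ::
  "complex ^ 'n ^ 'm \<Rightarrow> 'w measure \<Rightarrow> (nat \<Rightarrow> 'w \<Rightarrow> 'm) \<Rightarrow> bool"
where
  "kaczmarz_sampling A P r \<longleftrightarrow>
     prob_space P \<and>
     prob_space.indep_vars P (\<lambda>_. count_space UNIV) r UNIV \<and>
     (\<forall>k j. measure P {\<omega> \<in> space P. r k \<omega> = j} = (norm (row_vec A j))\<^sup>2 / (frobenius_norm A)\<^sup>2)"

lemma kaczmarz_sampling_exists:
  fixes A :: "complex ^ 'n ^ 'm"
  assumes "A \<noteq> 0"
  shows "\<exists>(P :: (nat \<Rightarrow> 'm) measure) r. kaczmarz_sampling A P r"
proof -
  let ?w = "\<lambda>j. (norm (row_vec A j))\<^sup>2 / (frobenius_norm A)\<^sup>2"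
  have "frobenius_norm A \<noteq> 0"
    using assms by (simp add: frobenius_norm_eq_norm)
  hence sum1: "(\<Sum>j\<in>UNIV. ?w j) = 1"
    by (simp add: sum_divide_distrib[symmetric] frobenius_norm_sq[symmetric])
  define p where "p = embed_pmf ?w"
  have p: "pmf p j = ?w j" for j
    unfolding p_def
  proof (rule pmf_embed_pmf)
    show "(\<integral>\<^sup>+ j. ennreal (?w j) \<partial>count_space UNIV) = 1"
      using sum1 by (simp add: nn_integral_count_space_finite)
  qed simp
  let ?P = "PiM (UNIV :: nat set) (\<lambda>_. measure_pmf p)"
  interpret P: prob_space ?P
    by (intro prob_space_PiM measure_pmf.prob_space_axioms)
  have comp: "(\<lambda>\<omega>. \<omega> k) \<in> measurable ?P (count_space UNIV)" for k :: nat
    using measurable_component_singleton[of k UNIV "\<lambda>_. measure_pmf p"] by simp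
  have dist0: "distr ?P (measure_pmf p) (\<lambda>\<omega>. \<omega> k) = measure_pmf p" for k :: nat
    by (rule distr_PiM_component) (simp_all add: measure_pmf.prob_space_axioms)
  have dist: "distr ?P (count_space UNIV) (\<lambda>\<omega>. \<omega> k) = measure_pmf p" for k :: nat
    using distr_cong[of ?P ?P "count_space UNIV" "measure_pmf p" "\<lambda>\<omega>. \<omega> k" "\<lambda>\<omega>. \<omega> k"] dist0[of k]
    by simp
  have "P.indep_vars (\<lambda>_. count_space UNIV) (\<lambda>k \<omega>. \<omega> k) UNIV"
  proof (subst P.indep_vars_iff_distr_eq_PiM)
    have "distr ?P (\<Pi>\<^sub>M i\<in>UNIV. count_space UNIV) (\<lambda>x. \<lambda>i\<in>UNIV. x i) = distr ?P ?P (\<lambda>x. x)"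
      by (intro distr_cong sets_PiM_cong) (simp_all add: restrict_def)
    also have "\<dots> = ?P" by (rule distr_id)
    finally show "distr ?P (\<Pi>\<^sub>M i\<in>UNIV. count_space UNIV) (\<lambda>x. \<lambda>i\<in>UNIV. x i)
        = (\<Pi>\<^sub>M i\<in>UNIV. distr ?P (count_space UNIV) (\<lambda>\<omega>. \<omega> i))"
      by (simp only: dist)
  qed (use comp in simp_all)
  moreover have "measure ?P {\<omega> \<in> space ?P. \<omega> k = j} = ?w j" for k j
  proof -
    have "measure ?P {\<omega> \<in> space ?P. \<omega> k = j}
        = measure (distr ?P (count_space UNIV) (\<lambda>\<omega>. \<omega> k)) {j}"
      by (subst measure_distr[OF comp]) (auto intro!: arg_cong[where f = "measure ?P"])
    also have "\<dots> = ?w j"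
      by (simp add: dist p measure_pmf_single)
    finally show ?thesis .
  qed
  ultimately have "kaczmarz_sampling A ?P (\<lambda>k \<omega>. \<omega> k)"
    unfolding kaczmarz_sampling_def using P.prob_space_axioms by blast
  thus ?thesis by blast
qed

end

theory Submission
  imports Defs
begin

text \<open>Start the iteration at \<open>x\<^sub>0 = x + v\<close>, where \<open>v\<close> is a unit vector on which
  \<open>A\<close> attains its smallest stretching factor \<open>\<sigma> = 1 / inverse_norm A\<close>. The minimum of
  \<open>norm (A *v z) / norm z\<close> is stationary at \<open>v\<close>, which gives the weak eigenvector identity
  \<open>inner (A *v v) (A *v w) = \<sigma>\<^sup>2 * inner v w\<close>
  (\<open>linear_lower_bound_attained_inner\<close>).

  One step projects the error \<open>e\<close> onto the complement of a random row. The row probabilities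
  cancel the normalisation of the projections, so that the mean of the projected error is \<open>e\<close> minus
  \<open>A\<^sup>* A e\<close> divided by the squared Frobenius norm (\<open>kaczmarz_error_step_mean\<close>, tested against a
  vector). Tested against \<open>v\<close>, this says that the expected component of the error along
  \<open>v\<close> is multiplied in each step by exactly \<open>q = 1 - 1 / (scaled_cond A)\<^sup>2\<close>; by independence of the
  indices it equals \<open>q ^ k\<close> after \<open>k\<close> steps (\<open>kaczmarz_expected_component\<close>).

  The mean square norm of a random vector is at least the square of its mean component along a unit
  vector, so the expected squared error is at least \<open>q ^ (2 * k)\<close>, and Bernoulli's inequality bounds this below by
  \<open>1 - 2 * k / (scaled_cond A)\<^sup>2\<close>.

  Components are measured with the real inner product \<open>inner\<close>, the real part of
  \<open>cinner_vec\<close>, so that every quantity whose expectation is taken is real.\<close>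

section \<open>Smallest singular vectors\<close>

lemma inj_matrix_of_full_column_rank:
  fixes A :: "'a::field ^ 'n ^ 'm"
  assumes "rank A = CARD('n)"
  shows "inj ((*v) A)"
  using assms
  by (simp add: row_rank_def_gen matrix_left_invertible_span_rows_gen vec.dim_eq_full [symmetric]
      vec.dimension_def card_cart_basis flip: matrix_left_invertible_injective)

lemma cinner_cnj: "cnj (cinner_vec u v) = cinner_vec v u"
  by (simp add: cinner_vec_def mult.commute)

lemma inner_eq_Re_cinner: "inner u v = Re (cinner_vec u v)"
  by (simp add: inner_vec_def cinner_vec_def inner_complex_def)

lemma cinner_scale_right: "cinner_vec u (c *s v) = c * cinner_vec u v"
  by (simp add: cinner_vec_def sum_distrib_left mult_ac)

lemma linear_matrix_vector_mult_complex: "linear ((*v) (A :: complex ^ 'n ^ 'm))"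
  by (intro linearI) (simp_all add: matrix_vector_right_distrib matrix_vector_mult_def
        vec_eq_iff scaleR_sum_right distrib_left sum.distrib)

text \<open>By compactness of the unit sphere. Such a \<open>v\<close> is a right singular vector for the smallest
  singular value, and serves as the initial error.\<close>

lemma inverse_norm_attained:
  fixes A :: "complex ^ 'n ^ 'm"
  assumes inj: "inj ((*v) A)"
  obtains v where "norm v = 1" and "norm (A *v v) = 1 / inverse_norm A"
proof -
  let ?S = "sphere (0 :: complex ^ 'n) 1"
  have lin: "linear ((*v) A)"
    by (rule linear_matrix_vector_mult_complex)
  have cont: "continuous_on ?S (\<lambda>z. norm (A *v z))"
    by (intro continuous_on_norm linear_continuous_on linear_conv_bounded_linear[THEN iffD1] lin)
  have "axis undefined (1::complex) \<in> ?S"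
    by (simp add: norm_axis_1)
  hence "?S \<noteq> {}" by blast
  then obtain v where v: "norm v = 1"
    and vmin: "\<And>z. norm z = 1 \<Longrightarrow> norm (A *v v) \<le> norm (A *v z)"
    using continuous_attains_inf[OF compact_sphere _ cont] by auto
  have pos: "norm (A *v v) > 0"
    using injD[OF inj, of v 0] v by auto
  have "norm (A *v v) * norm z \<le> norm (A *v z)" for z
  proof (cases "z = 0")
    case False
    have "norm (A *v v) \<le> norm (A *v ((1 / norm z) *\<^sub>R z))"
      using False by (intro vmin) simp
    also have "\<dots> = norm (A *v z) / norm z"
      using linear_scale[OF lin] by simp
    finally show ?thesis
      using False by (simp add: pos_le_divide_eq)
  qed simp
  hence "inverse_norm A \<le> 1 / norm (A *v v)"
    using pos by (intro inverse_norm_least(3)[OF inj]) simp_all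
  moreover have "1 / inverse_norm A \<le> norm (A *v v)"
    using inverse_norm_least(2)[OF inj, of v] v by simp
  ultimately have "norm (A *v v) = 1 / inverse_norm A"
    using pos inverse_norm_least(1)[OF inj] by (simp add: field_simps)
  with v show ?thesis by (rule that)
qed

text \<open>The quadratic form \<open>(norm (f z))\<^sup>2 - c\<^sup>2 * (norm z)\<^sup>2\<close> is nonnegative and vanishes at
  \<open>v\<close>, so its derivative at \<open>v\<close> in every direction \<open>w\<close> vanishes too. For \<open>f = (*v) A\<close> this
  says that \<open>v\<close> is an eigenvector of \<open>A\<^sup>* A\<close>, in a form that needs no adjoint.\<close>

lemma linear_lower_bound_attained_inner:
  fixes f :: "'a::real_inner \<Rightarrow> 'b::real_inner"
  assumes lin: "linear f" and c: "c \<ge> 0"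
    and lower: "\<And>z. c * norm z \<le> norm (f z)"
    and attained: "norm (f v) = c * norm v"
  shows "inner (f v) (f w) = c\<^sup>2 * inner v w"
proof -
  define d where "d = inner (f v) (f w) - c\<^sup>2 * inner v w"
  define q where "q = (norm (f w))\<^sup>2 - c\<^sup>2 * (norm w)\<^sup>2"
  have q: "2 * t * d + t\<^sup>2 * q \<ge> 0" for t
  proof -
    have "(c * norm (v + t *\<^sub>R w))\<^sup>2 \<le> (norm (f (v + t *\<^sub>R w)))\<^sup>2"
      by (intro power_mono lower) (simp add: c)
    moreover have "f (v + t *\<^sub>R w) = f v + t *\<^sub>R f w"
      by (simp add: lin linear_add linear_scale)
    moreover have "(norm (f v))\<^sup>2 = c\<^sup>2 * (norm v)\<^sup>2"
      by (simp add: attained power_mult_distrib)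
    ultimately show ?thesis
      unfolding d_def q_def power_mult_distrib power2_norm_eq_inner
      by (simp add: algebra_simps inner_commute power2_eq_square)
  qed
  have "d = 0"
  proof (rule ccontr)
    assume "d \<noteq> 0"
    \<comment> \<open>A step against the sign of \<open>d\<close>, short enough for the linear term to dominate the quadratic one.\<close>
    define s where "s = 1 / (\<bar>q\<bar> + 1)"
    have s: "s > 0" "s * q < 1"
      by (auto simp: s_def field_simps)
    have "2 * (- s * d) * d + (- s * d)\<^sup>2 * q = (s * d\<^sup>2) * (s * q - 2)"
      by (simp add: algebra_simps power2_eq_square)
    also have "\<dots> < 0"
      using s \<open>d \<noteq> 0\<close> by (intro mult_pos_neg) simp_all
    finally show False using q[of "- s * d"] by simp
  qed
  thus ?thesis by (simp add: d_def)
qed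

section \<open>One step of the error\<close>

text \<open>The projection of \<open>e\<close> onto the orthogonal complement of the \<open>j\<close>-th row vector. For a zero row
  the division by zero makes it the identity, in agreement with \<open>kaczmarz\<close>.\<close>

definition kaczmarz_error_step :: "complex ^ 'n ^ 'm \<Rightarrow> 'm \<Rightarrow> complex ^ 'n \<Rightarrow> complex ^ 'n" where
  "kaczmarz_error_step A j e =
     e - (cinner_vec (row_vec A j) e / of_real ((norm (row_vec A j))\<^sup>2)) *s row_vec A j"

text \<open>Consistency of the system turns the affine iteration for \<open>x\<^sub>k\<close> into a linear one for the error.\<close>

lemma kaczmarz_error_Suc:
  assumes "A *v x = b"
  shows "kaczmarz A b x0 r (Suc k) - x = kaczmarz_error_step A (r k) (kaczmarz A b x0 r k - x)"
proof -
  have "b $ j = cinner_vec (row_vec A j) x" for j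
    using assms by (simp add: cinner_row_vec)
  thus ?thesis
    by (simp add: kaczmarz_error_step_def Let_def vec_eq_iff cinner_row_vec
        matrix_vector_mult_diff_distrib diff_divide_distrib algebra_simps)
qed

text \<open>The factor \<open>(norm (row_vec A j))\<^sup>2\<close> in the probability of row \<open>j\<close> cancels the denominator of
  the projection, and the remaining products of entries of \<open>A *v v\<close> and \<open>A *v e\<close> add up to an
  inner product.\<close>

lemma kaczmarz_error_step_mean:
  fixes A :: "complex ^ 'n ^ 'm"
  assumes "A \<noteq> 0"
  shows "(\<Sum>j\<in>UNIV. (norm (row_vec A j))\<^sup>2 / (frobenius_norm A)\<^sup>2 * inner v (kaczmarz_error_step A j e))
       = inner v e - inner (A *v v) (A *v e) / (frobenius_norm A)\<^sup>2"
proof -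
  let ?F = "(frobenius_norm A)\<^sup>2" and ?w = "\<lambda>j. (norm (row_vec A j))\<^sup>2"
  have F: "?F \<noteq> 0" using assms by (simp add: frobenius_norm_eq_norm)
  have "?w j / ?F * inner v (kaczmarz_error_step A j e)
      = ?w j / ?F * inner v e - inner ((A *v v) $ j) ((A *v e) $ j) / ?F" for j
  proof (cases "row_vec A j = 0")
    case True
    hence "(A *v v) $ j = 0"
      by (simp flip: cinner_row_vec add: cinner_vec_def)
    with True show ?thesis by simp
  next
    case False
    have "cinner_vec v (row_vec A j) = cnj ((A *v v) $ j)"
      by (metis cinner_cnj cinner_row_vec)
    hence "inner v (kaczmarz_error_step A j e)
        = inner v e - Re ((A *v e) $ j / of_real (?w j) * cnj ((A *v v) $ j))"
      by (simp add: kaczmarz_error_step_def inner_diff_right inner_eq_Re_cinner[of v "_ *s _"]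
          cinner_scale_right cinner_row_vec)
    also have "Re ((A *v e) $ j / of_real (?w j) * cnj ((A *v v) $ j))
        = inner ((A *v v) $ j) ((A *v e) $ j) / ?w j"
      by (simp only: times_divide_eq_left Re_divide_of_real) (simp add: inner_complex_def mult.commute)
    finally show ?thesis using False by (simp add: right_diff_distrib)
  qed
  hence "(\<Sum>j\<in>UNIV. ?w j / ?F * inner v (kaczmarz_error_step A j e))
      = (\<Sum>j\<in>UNIV. ?w j) / ?F * inner v e - (\<Sum>j\<in>UNIV. inner ((A *v v) $ j) ((A *v e) $ j)) / ?F"
    by (simp add: sum_subtractf sum_divide_distrib sum_distrib_right)
  also have "(\<Sum>j\<in>UNIV. ?w j) / ?F = 1"
    using F by (simp flip: frobenius_norm_sq)
  finally show ?thesis by (simp add: inner_vec_def)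
qed

section \<open>Randomness of the iterates\<close>

text \<open>Conditioning on an independent index with finitely many values, without conditional
  expectations: split \<open>f\<close> into the sum over \<open>j\<close> of the indicator of \<open>J (X \<omega>) = j\<close> times
  \<open>f j (Y \<omega>)\<close>, and factor each term. The index is read off from \<open>X\<close> by \<open>J\<close> because \<open>indep_var\<close>
  requires \<open>X\<close> and \<open>Y\<close> to have values in the same type, whereas the new index and the list of
  past indices do not.\<close>

lemma (in prob_space) expectation_indep_finite_index:
  fixes J :: "'c \<Rightarrow> 'm::finite" and f :: "'m \<Rightarrow> 'c \<Rightarrow> real"
  assumes indep: "indep_var L X N Y"
    and J: "J \<in> measurable L (count_space UNIV)"
    and f: "\<And>j. f j \<in> borel_measurable N"
    and int: "\<And>j. integrable M (\<lambda>\<omega>. f j (Y \<omega>))"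
  shows "expectation (\<lambda>\<omega>. f (J (X \<omega>)) (Y \<omega>))
       = (\<Sum>j\<in>UNIV. prob {\<omega> \<in> space M. J (X \<omega>) = j} * expectation (\<lambda>\<omega>. f j (Y \<omega>)))"
proof -
  let ?I = "\<lambda>j s. indicator {j} (J s) :: real"
  have JX: "(\<lambda>\<omega>. J (X \<omega>)) \<in> measurable M (count_space UNIV)"
    using indep_var_rv1[OF indep] J by (rule measurable_compose)
  have ev: "{\<omega> \<in> space M. J (X \<omega>) = j} \<in> events" for j
    using measurable_sets[OF JX, of "{j}"] by (simp add: vimage_def Int_def conj_commute)
  have I: "?I j \<in> borel_measurable L" for j
    using J by (rule measurable_compose) simp
  have int_I: "integrable M (?I j \<circ> X)" for j
    using measurable_comp[OF indep_var_rv1[OF indep] I]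
    by (intro integrable_const_bound[of _ 1]) (auto simp: indicator_def)
  have indep': "indep_var borel (?I j \<circ> X) borel (f j \<circ> Y)" for j
    by (intro indep_var_compose[OF indep] f I)
  have int_f: "integrable M (f j \<circ> Y)" for j
    using int by (simp add: o_def)
  note product = indep_var_lebesgue_integral[OF indep' int_I int_f]
    indep_var_integrable[OF indep' int_I int_f]
  have split: "f (J (X \<omega>)) (Y \<omega>) = (\<Sum>j\<in>UNIV. (?I j \<circ> X) \<omega> * (f j \<circ> Y) \<omega>)" for \<omega>
    by (simp add: indicator_def if_distrib[where f = "\<lambda>c. c * _"] cong: if_cong)
  have prob: "expectation (?I j \<circ> X) = prob {\<omega> \<in> space M. J (X \<omega>) = j}" for j
  proof -
    have "expectation (?I j \<circ> X) = expectation (indicator {\<omega> \<in> space M. J (X \<omega>) = j})"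
      by (intro Bochner_Integration.integral_cong) (auto simp: indicator_def)
    thus ?thesis using ev by simp
  qed
  have "expectation (\<lambda>\<omega>. f (J (X \<omega>)) (Y \<omega>))
      = (\<Sum>j\<in>UNIV. expectation (?I j \<circ> X) * expectation (f j \<circ> Y))"
    unfolding split using product by (simp add: Bochner_Integration.integral_sum del: o_apply)
  thus ?thesis by (simp add: prob) (simp add: o_def)
qed

text \<open>The \<open>k\<close>-th iterate depends only on the first \<open>k\<close> indices. Hence it is a function on the
  finite discrete space of these indices, which makes it measurable, bounded, and independent of
  the next index.\<close>

lemma kaczmarz_cong:
  assumes "\<And>i. i < k \<Longrightarrow> r i = s i"
  shows "kaczmarz A b x0 r k = kaczmarz A b x0 s k"
  using assms by (induction k) (simp_all add: Let_def)

lemma measurable_kaczmarz_indices: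
  "(\<lambda>r. g (kaczmarz A b x0 r k))
     \<in> borel_measurable (PiM {..<k} (\<lambda>_. count_space (UNIV :: 'm::finite set)))"
  by (subst count_space_PiM_finite) (simp_all add: uncountable_def countable_finite)

lemma finite_kaczmarz_iterates:
  fixes A :: "complex ^ 'n ^ 'm"
  shows "finite (range (\<lambda>r. kaczmarz A b x0 r k))"
proof -
  have "range (\<lambda>r. kaczmarz A b x0 r k)
      \<subseteq> (\<lambda>r. kaczmarz A b x0 r k) ` (PiE {..<k} (\<lambda>_. UNIV))"
  proof clarify
    fix r :: "nat \<Rightarrow> 'm"
    have "kaczmarz A b x0 r k = kaczmarz A b x0 (restrict r {..<k}) k"
      by (rule kaczmarz_cong) simp
    thus "kaczmarz A b x0 r k \<in> (\<lambda>r. kaczmarz A b x0 r k) ` (PiE {..<k} (\<lambda>_. UNIV))"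
      by (auto intro!: image_eqI)
  qed
  thus ?thesis by (rule finite_subset) (auto intro!: finite_PiE)
qed

lemma kaczmarz_sampling_integrable:
  fixes A :: "complex ^ 'n ^ 'm" and g :: "complex ^ 'n \<Rightarrow> real"
  assumes "kaczmarz_sampling A P r"
  shows "integrable P (\<lambda>\<omega>. g (kaczmarz A b x0 (\<lambda>i. r i \<omega>) k))"
proof -
  interpret prob_space P using assms by (simp add: kaczmarz_sampling_def)
  let ?N = "PiM {..<k} (\<lambda>_. count_space (UNIV :: 'm set))"
  have "indep_vars (\<lambda>_. count_space UNIV) r UNIV"
    using assms by (simp add: kaczmarz_sampling_def)
  hence "(\<lambda>\<omega>. restrict (\<lambda>i. r i \<omega>) {..<k}) \<in> measurable P ?N"
    by (intro measurable_restrict) (auto simp: indep_vars_def)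
  from measurable_compose[OF this measurable_kaczmarz_indices[where g = g and A = A and b = b]]
  have "(\<lambda>\<omega>. g (kaczmarz A b x0 (restrict (\<lambda>i. r i \<omega>) {..<k}) k)) \<in> borel_measurable P" .
  moreover have "kaczmarz A b x0 (restrict (\<lambda>i. r i \<omega>) {..<k}) k = kaczmarz A b x0 (\<lambda>i. r i \<omega>) k" for \<omega>
    by (rule kaczmarz_cong) simp
  ultimately have meas: "(\<lambda>\<omega>. g (kaczmarz A b x0 (\<lambda>i. r i \<omega>) k)) \<in> borel_measurable P"
    by (simp only:)
  let ?S = "(\<lambda>e. \<bar>g e\<bar>) ` range (\<lambda>r. kaczmarz A b x0 r k)"
  have "finite ?S" by (intro finite_imageI finite_kaczmarz_iterates)
  hence "\<bar>g (kaczmarz A b x0 s k)\<bar> \<le> Max ?S" for s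
    by (rule Max_ge) blast
  with meas show ?thesis
    by (intro integrable_const_bound[of _ "Max ?S"]) simp_all
qed

text \<open>The index of step \<open>k\<close> is independent of the \<open>k\<close>-th iterate, so it can be averaged out
  inside the expectation.\<close>

lemma kaczmarz_sampling_expectation_Suc:
  fixes A :: "complex ^ 'n ^ 'm"
  assumes samp: "kaczmarz_sampling A P r" and sol: "A *v x = b"
  shows "prob_space.expectation P (\<lambda>\<omega>. g (kaczmarz A b x0 (\<lambda>i. r i \<omega>) (Suc k) - x))
       = prob_space.expectation P (\<lambda>\<omega>. \<Sum>j\<in>UNIV. (norm (row_vec A j))\<^sup>2 / (frobenius_norm A)\<^sup>2
            * g (kaczmarz_error_step A j (kaczmarz A b x0 (\<lambda>i. r i \<omega>) k - x)))"
proof -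
  interpret prob_space P using samp by (simp add: kaczmarz_sampling_def)
  let ?C = "count_space (UNIV :: 'm set)"
  let ?X = "\<lambda>\<omega>. restrict (\<lambda>i. r i \<omega>) {k}" and ?Y = "\<lambda>\<omega>. restrict (\<lambda>i. r i \<omega>) {..<k}"
  let ?f = "\<lambda>j s. g (kaczmarz_error_step A j (kaczmarz A b x0 s k - x))"
  have indep: "indep_vars (\<lambda>_. ?C) r UNIV"
    and p: "\<And>j. prob {\<omega> \<in> space P. r k \<omega> = j} = (norm (row_vec A j))\<^sup>2 / (frobenius_norm A)\<^sup>2"
    using samp by (simp_all add: kaczmarz_sampling_def)
  have indep_k: "indep_var (PiM {k} (\<lambda>_. ?C)) ?X (PiM {..<k} (\<lambda>_. ?C)) ?Y"
    by (rule indep_var_restrict[OF indep]) auto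
  have past: "kaczmarz A b x0 (\<lambda>i. r i \<omega>) k = kaczmarz A b x0 (?Y \<omega>) k" for \<omega>
    by (rule kaczmarz_cong) simp
  have int: "integrable P (\<lambda>\<omega>. ?f j (?Y \<omega>))" for j
    using kaczmarz_sampling_integrable[OF samp, of "\<lambda>y. g (kaczmarz_error_step A j (y - x))" b x0 k]
    by (simp add: past)
  have "expectation (\<lambda>\<omega>. g (kaczmarz A b x0 (\<lambda>i. r i \<omega>) (Suc k) - x))
      = expectation (\<lambda>\<omega>. ?f (?X \<omega> k) (?Y \<omega>))"
    by (simp add: kaczmarz_error_Suc[OF sol] past del: kaczmarz.simps)
  also have "\<dots> = (\<Sum>j\<in>UNIV. prob {\<omega> \<in> space P. ?X \<omega> k = j} * expectation (\<lambda>\<omega>. ?f j (?Y \<omega>)))"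
    by (rule expectation_indep_finite_index[OF indep_k, of "\<lambda>s. s k", OF _
        measurable_kaczmarz_indices[where g = "\<lambda>y. g (kaczmarz_error_step A _ (y - x))"] int])
      (simp add: measurable_component_singleton)
  also have "\<dots> = expectation (\<lambda>\<omega>. \<Sum>j\<in>UNIV. prob {\<omega> \<in> space P. r k \<omega> = j} * ?f j (?Y \<omega>))"
    using int by simp
  finally show ?thesis by (simp add: p past)
qed

section \<open>The component along a singular vector\<close>

text \<open>A step multiplies the mean component along an eigenvector of \<open>A\<^sup>* A\<close> by a constant, whatever
  the other components of the error are.
  The recursion for this single component is therefore closed and exact.\<close>

lemma kaczmarz_expected_component:
  fixes A :: "complex ^ 'n ^ 'm"
  assumes samp: "kaczmarz_sampling A P r" and sol: "A *v x = b" and "A \<noteq> 0"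
    and eig: "\<And>w. inner (A *v v) (A *v w) = c * inner v w"
  shows "prob_space.expectation P (\<lambda>\<omega>. inner v (kaczmarz A b x0 (\<lambda>i. r i \<omega>) k - x))
       = (1 - c / (frobenius_norm A)\<^sup>2) ^ k * inner v (x0 - x)"
proof (induction k)
  case 0
  interpret prob_space P using samp by (simp add: kaczmarz_sampling_def)
  show ?case by (simp add: prob_space)
next
  case (Suc k)
  have "prob_space.expectation P (\<lambda>\<omega>. inner v (kaczmarz A b x0 (\<lambda>i. r i \<omega>) (Suc k) - x))
      = prob_space.expectation P (\<lambda>\<omega>. (1 - c / (frobenius_norm A)\<^sup>2)
          * inner v (kaczmarz A b x0 (\<lambda>i. r i \<omega>) k - x))"
    unfolding kaczmarz_sampling_expectation_Suc[OF samp sol]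
      kaczmarz_error_step_mean[OF \<open>A \<noteq> 0\<close>] eig
    by (simp only: left_diff_distrib mult_1 times_divide_eq_left)
  with Suc.IH show ?case by simp
qed

theorem theorem3:
  fixes A :: "complex ^ 'n ^ 'm"
    and b :: "complex ^ 'm"
    and x :: "complex ^ 'n"
  assumes size: "CARD('m) \<ge> CARD('n)"
    and full_rank: "rank A = min CARD('m) CARD('n)"
    and solution: "A *v x = b"
  shows "\<exists>x0. x0 \<noteq> x \<and>
    (\<forall>(P :: 'w measure) r. kaczmarz_sampling A P r \<longrightarrow>
      (\<forall>k\<ge>1. prob_space.expectation P
                (\<lambda>\<omega>. (norm (kaczmarz A b x0 (\<lambda>i. r i \<omega>) k - x))\<^sup>2)
              \<ge> (1 - 2 * real k / (scaled_cond A)\<^sup>2) * (norm (x0 - x))\<^sup>2))"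
proof -
  have inj: "inj ((*v) A)"
    using size full_rank by (intro inj_matrix_of_full_column_rank) simp
  obtain v where v: "norm v = 1" and attained: "norm (A *v v) = 1 / inverse_norm A"
    using inverse_norm_attained[OF inj] by blast
  have "v \<noteq> 0" using v by auto
  moreover have "A *v v \<noteq> 0"
    using injD[OF inj, of v 0] \<open>v \<noteq> 0\<close> by auto
  ultimately have "A \<noteq> 0" by auto
  have eig: "inner (A *v v) (A *v w) = (1 / inverse_norm A)\<^sup>2 * inner v w" for w
    using v attained inverse_norm_least[OF inj]
    by (intro linear_lower_bound_attained_inner linear_matrix_vector_mult_complex)
      (simp_all add: less_imp_le)
  define q where "q = 1 - 1 / (scaled_cond A)\<^sup>2"
  have q: "1 - (1 / inverse_norm A)\<^sup>2 / (frobenius_norm A)\<^sup>2 = q"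
    by (simp add: q_def scaled_cond_def power_mult_distrib power_divide)
  have lower: "(1 - 2 * real k / (scaled_cond A)\<^sup>2) * (norm (x + v - x))\<^sup>2
      \<le> prob_space.expectation P (\<lambda>\<omega>. (norm (kaczmarz A b (x + v) (\<lambda>i. r i \<omega>) k - x))\<^sup>2)"
    if samp: "kaczmarz_sampling A P r" for P :: "'w measure" and r k
  proof -
    interpret prob_space P using samp by (simp add: kaczmarz_sampling_def)
    let ?e = "\<lambda>\<omega>. kaczmarz A b (x + v) (\<lambda>i. r i \<omega>) k - x"
    have int: "integrable P (\<lambda>\<omega>. inner v (?e \<omega>))" "integrable P (\<lambda>\<omega>. (norm (?e \<omega>))\<^sup>2)"
      using kaczmarz_sampling_integrable[OF samp, of "\<lambda>y. inner v (y - x)"]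
        kaczmarz_sampling_integrable[OF samp, of "\<lambda>y. (norm (y - x))\<^sup>2"] by - assumption+
    have mean: "expectation (\<lambda>\<omega>. inner v (?e \<omega>)) = q ^ k"
    proof -
      have "inner v (x + v - x) = 1"
        using v by (simp add: dot_square_norm)
      thus ?thesis
        by (simp only: kaczmarz_expected_component[OF samp solution \<open>A \<noteq> 0\<close> eig] q mult_1_right)
    qed
    \<comment> \<open>The tangent of the squared norm at \<open>q ^ k *\<^sub>R v\<close>, whose coefficient is the mean component along
      \<open>v\<close>. At \<open>?e\<close> its expectation is \<open>q ^ (2 * k)\<close>.\<close>
    have pointwise: "2 * q ^ k * inner v e - (q ^ k)\<^sup>2 \<le> (norm e)\<^sup>2" for e
    proof -
      have "0 \<le> (norm (e - q ^ k *\<^sub>R v))\<^sup>2" by simp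
      also have "\<dots> = (norm e)\<^sup>2 - 2 * q ^ k * inner v e + (q ^ k)\<^sup>2 * (norm v)\<^sup>2"
        unfolding power2_norm_eq_inner
        by (simp add: algebra_simps inner_commute power2_eq_square)
      finally show ?thesis using v by simp
    qed
    \<comment> \<open>The exponent is even, so Bernoulli's inequality holds for every base.\<close>
    have "1 - 2 * real k / (scaled_cond A)\<^sup>2 \<le> q ^ (2 * k)"
      using Bernoulli_inequality_even[of "2 * k" "- (1 / (scaled_cond A)\<^sup>2)"] by (simp add: q_def)
    also have "\<dots> = 2 * q ^ k * q ^ k - (q ^ k)\<^sup>2"
      by (simp add: power_even_eq power2_eq_square[of "q ^ k"])
    also have "\<dots> = expectation (\<lambda>\<omega>. 2 * q ^ k * inner v (?e \<omega>) - (q ^ k)\<^sup>2)"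
      using int by (simp add: mean prob_space)
    also have "\<dots> \<le> expectation (\<lambda>\<omega>. (norm (?e \<omega>))\<^sup>2)"
      using int pointwise by (intro integral_mono) simp_all
    finally show ?thesis using v by simp
  qed
  show ?thesis
  proof (intro exI[of _ "x + v"] conjI allI impI)
    show "x + v \<noteq> x" using \<open>v \<noteq> 0\<close> by simp
  qed (rule lower)
qed

end
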